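(* Let $r\ge1$, let $\theta=\alpha_1+\cdots+\alpha_r$ be the highest root of $\mathfrak{sl}_{r+1}(\mathbb{C})$, and let $I\subseteq[r]$ be nonempty. Then $\sigma\in\mathcal{A}(\theta,\alpha_I)$ if and only if $\sigma=1$ or $\sigma=\prod_{i\in\mathcal{I}}s_i$ for some (possibly empty) set $\mathcal{I}$ of pairwise nonconsecutive integers contained in $([r]\setminus I)\setminus\{1,r\}$.
   Context: Notation: $[n]=\{1,\dots,n\}$. In $\mathfrak{sl}_{r+1}(\mathbb{C})$, with $e_1,\dots,e_{r+1}$ the standard basis of $\mathbb{R}^{r+1}$, the simple roots are $\alpha_i=e_i-e_{i+1}$ ($i\in[r]$), the positive roots are $\alpha_i+\alpha_{i+1}+\cdots+\alpha_j$ for $1\le i\le j\le r$, $\theta=\alpha_1+\cdots+\alpha_r$, and $\rho$ is half the sum of the positive roots. The Weyl group $W\cong\mathfrak{S}_{r+1}$ is generated by the simple reflections $s_i$ (reflection through the hyperplane orthogonal to $\alpha_i$). Kostant's partition function $\wp(\xi)$ is the number of ways to write $\xi$ as a nonnegative integral sum of positive roots ($\wp(0)=1$). The Weyl alternation set is $\mathcal{A}(\lambda,\mu)=\{\sigma\in W:\wp(\sigma(\lambda+\rho)-\rho-\mu)>0\}$. For $I\subseteq[r]$, $\alpha_I=\sum_{i\in I}\alpha_i$. Since the $s_i$ with nonconsecutive indices commute, $\prod_{i\in\mathcal{I}}s_i$ is well defined; the empty product is $1$. *)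

theory Defs
  imports
    Complex_Main
    "HOL-Library.Function_Algebras"
    "HOL-Library.Multiset"
    "HOL-Algebra.Bij"
    "HOL-Algebra.Generated_Groups"
begin

text \<open>
  Vectors of \<open>\<real>\<^sup>r\<^sup>+\<^sup>1\<close> are functions \<open>nat \<Rightarrow> real\<close> whose coordinates are those with index in
  \<open>{1..r + 1}\<close>; addition, subtraction and sums of vectors are pointwise. All coordinates outside
  \<open>{1..r + 1}\<close> are fixed by the Weyl group, so letting it act on all of \<open>nat \<Rightarrow> real\<close> gives the same
  group as its action on \<open>\<real>\<^sup>r\<^sup>+\<^sup>1\<close>.
\<close>

type_synonym vec = "nat \<Rightarrow> real"

definition std_basis :: "nat \<Rightarrow> vec" where
  "std_basis i = (\<lambda>k. if k = i then 1 else 0)"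

definition inner_prod :: "nat \<Rightarrow> vec \<Rightarrow> vec \<Rightarrow> real" where
  "inner_prod r u v = (\<Sum>k = 1..r + 1. u k * v k)"

definition simple_root :: "nat \<Rightarrow> vec" where
  "simple_root i = std_basis i - std_basis (i + 1)"

definition root_sum :: "nat set \<Rightarrow> vec" where
  "root_sum I = (\<Sum>i\<in>I. simple_root i)"

definition positive_roots :: "nat \<Rightarrow> vec set" where
  "positive_roots r = {(\<Sum>k = i..j. simple_root k) | i j. 1 \<le> i \<and> i \<le> j \<and> j \<le> r}"

definition highest_root :: "nat \<Rightarrow> vec" where
  "highest_root r = (\<Sum>i = 1..r. simple_root i)"

definition half_sum :: "nat \<Rightarrow> vec" where
  "half_sum r = (\<lambda>k. (\<Sum>\<beta>\<in>positive_roots r. \<beta>) k / 2)"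

definition simple_reflection :: "nat \<Rightarrow> nat \<Rightarrow> vec \<Rightarrow> vec" where
  "simple_reflection r i v =
     (\<lambda>k. v k - 2 * inner_prod r v (simple_root i) / inner_prod r (simple_root i) (simple_root i)
                  * simple_root i k)"

definition weyl_group :: "nat \<Rightarrow> (vec \<Rightarrow> vec) set" where
  "weyl_group r = generate (BijGroup UNIV) (simple_reflection r ` {1..r})"

text \<open>
  A way of writing \<open>\<xi>\<close> as a nonnegative integral sum of positive roots is a multiset of positive roots
  with sum \<open>\<xi>\<close>. The set counted is finite (lemma \<open>finite_partitions\<close> below).
\<close>

definition kostant :: "nat \<Rightarrow> vec \<Rightarrow> nat" where
  "kostant r \<xi> = card {M. set_mset M \<subseteq> positive_roots r \<and> \<Sum>\<^sub># M = \<xi>}"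

definition weyl_alternation_set :: "nat \<Rightarrow> vec \<Rightarrow> vec \<Rightarrow> (vec \<Rightarrow> vec) set" where
  "weyl_alternation_set r \<Lambda> \<mu> =
     {\<sigma> \<in> weyl_group r. kostant r (\<sigma> (\<Lambda> + half_sum r) - half_sum r - \<mu>) > 0}"

definition nonconsecutive :: "nat set \<Rightarrow> bool" where
  "nonconsecutive J \<longleftrightarrow> (\<forall>i\<in>J. i + 1 \<notin> J)"

text \<open>
  The product is taken in increasing order of the indices; for nonconsecutive indices the order is
  irrelevant (lemma \<open>reflection_prod_any_order\<close> below).
\<close>

definition reflection_prod :: "nat \<Rightarrow> nat set \<Rightarrow> vec \<Rightarrow> vec" where
  "reflection_prod r J = foldr (\<lambda>i f. simple_reflection r i \<circ> f) (sorted_list_of_set J) id"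

lemma simple_root_apply:
  "simple_root i k = (if k = i then 1 else 0) - (if k = i + 1 then 1 else 0)"
  by (simp add: simple_root_def std_basis_def)

lemma inner_prod_simple_root:
  assumes "i \<in> {1..r}"
  shows "inner_prod r v (simple_root i) = v i - v (i + 1)"
proof -
  have "inner_prod r v (simple_root i)
      = (\<Sum>k = 1..r + 1. (if k = i then v k else 0) - (if k = i + 1 then v k else 0))"
    unfolding inner_prod_def by (rule sum.cong) (auto simp: simple_root_apply)
  also have "\<dots> = v i - v (i + 1)"
    using assms by (subst sum_subtractf) (simp add: sum.delta)
  finally show ?thesis .
qed

lemma simple_reflection_swap:
  assumes "i \<in> {1..r}"
  shows "simple_reflection r i v = v(i := v (i + 1), i + 1 := v i)"
  using assms
  by (auto simp: simple_reflection_def inner_prod_simple_root simple_root_apply fun_eq_iff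
      field_simps)

lemma simple_reflection_Bij:
  assumes "i \<in> {1..r}"
  shows "simple_reflection r i \<in> carrier (BijGroup UNIV)"
proof -
  have "simple_reflection r i (simple_reflection r i v) = v" for v
    using assms by (auto simp: simple_reflection_swap fun_eq_iff)
  then have "bij (simple_reflection r i)"
    by (intro o_bij[of "simple_reflection r i"]) (auto simp: fun_eq_iff)
  then show ?thesis by (simp add: BijGroup_def Bij_def)
qed

lemma simple_reflection_commute:
  assumes "i \<in> {1..r}" "j \<in> {1..r}" "j \<noteq> i + 1" "i \<noteq> j + 1"
  shows "simple_reflection r i \<circ> simple_reflection r j = simple_reflection r j \<circ> simple_reflection r i"
  using assms by (auto simp: simple_reflection_swap fun_eq_iff)

lemma reflection_prod_any_order:
  assumes "set xs \<subseteq> {1..r}" "nonconsecutive (set xs)" "distinct xs"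
  shows "foldr (\<lambda>i f. simple_reflection r i \<circ> f) xs id = reflection_prod r (set xs)"
proof -
  let ?f = "\<lambda>i f. simple_reflection r i \<circ> f"
  let ?ys = "sorted_list_of_set (set xs)"
  have "fold ?f (rev xs) = fold ?f (rev ?ys)"
  proof (rule fold_multiset_equiv)
    fix i j assume "i \<in> set (rev xs)" "j \<in> set (rev xs)"
    then have "simple_reflection r i \<circ> simple_reflection r j
             = simple_reflection r j \<circ> simple_reflection r i"
      using assms by (intro simple_reflection_commute) (auto simp: nonconsecutive_def)
    then show "?f i \<circ> ?f j = ?f j \<circ> ?f i"
      by (simp add: fun_eq_iff)
  next
    show "mset (rev xs) = mset (rev ?ys)"
      using assms(3) by (metis mset_rev set_eq_iff_mset_eq_distinct distinct_sorted_list_of_set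
          set_sorted_list_of_set List.finite_set)
  qed
  then show ?thesis unfolding reflection_prod_def foldr_conv_fold by (rule fun_cong)
qed

lemma finite_partitions:
  "finite {M. set_mset M \<subseteq> positive_roots r \<and> \<Sum>\<^sub># M = \<xi>}"
proof -
  define h :: "vec \<Rightarrow> real" where "h v = (\<Sum>k = 1..r + 1. - real k * v k)" for v
  have h0: "h 0 = 0" by (simp add: h_def)
  have hadd: "h (u + v) = h u + h v" for u v
    by (simp add: h_def sum.distrib [symmetric] algebra_simps)
  have hsum: "h (sum f A) = (\<Sum>a\<in>A. h (f a))" if "finite A" for A :: "nat set" and f
    using that by (induction A rule: finite_induct) (simp_all only: sum.empty sum.insert h0 hadd not_False_eq_True)
  have hsimple: "h (simple_root i) = 1" if "i \<in> {1..r}" for i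
    using inner_prod_simple_root[OF that, of "\<lambda>k. - real k"] by (simp add: h_def inner_prod_def)
  have hpos: "h \<beta> \<ge> 1" if "\<beta> \<in> positive_roots r" for \<beta>
  proof -
    from that obtain i j where ij: "1 \<le> i" "i \<le> j" "j \<le> r"
      and \<beta>: "\<beta> = (\<Sum>k = i..j. simple_root k)"
      by (auto simp: positive_roots_def)
    have "h \<beta> = (\<Sum>k = i..j. 1)"
      unfolding \<beta> hsum[OF finite_atLeastAtMost] using ij by (intro sum.cong hsimple) auto
    then show ?thesis using ij by simp
  qed
  have hsize: "real (size M) \<le> h (\<Sum>\<^sub># M)" if "set_mset M \<subseteq> positive_roots r" for M
    using that
  proof (induction M)
    case (add \<beta> M)
    have "h (\<Sum>\<^sub># (add_mset \<beta> M)) = h \<beta> + h (\<Sum>\<^sub># M)"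
      by (simp only: sum_mset.add_mset hadd)
    then show ?case using add hpos[of \<beta>] by (simp del: sum_mset.add_mset)
  qed (simp only: size_empty sum_mset.empty h0 of_nat_0)
  have fin: "finite (positive_roots r)"
  proof (rule finite_subset)
    show "positive_roots r \<subseteq> (\<lambda>(i, j). \<Sum>k = i..j. simple_root k) ` ({1..r} \<times> {1..r})"
      by (force simp: positive_roots_def)
  qed simp
  have "{M. set_mset M \<subseteq> positive_roots r \<and> \<Sum>\<^sub># M = \<xi>}
      \<subseteq> (\<Union>n\<in>{..nat \<lfloor>h \<xi>\<rfloor>}. multisets_of_size (positive_roots r) n)"
    using hsize by (force simp: multisets_of_size_def le_nat_floor)
  moreover have "finite \<dots>"
    using fin by (auto intro: finite_multisets_of_size)
  ultimately show ?thesis by (rule finite_subset)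
qed

end

theory Submission
  imports Defs "HOL-Combinatorics.Permutations"
begin

text \<open>
  The Weyl group permutes coordinates. By comparing partial sums of coordinates, \<open>\<sigma>\<close> lies in the
  alternation set only if the corresponding permutation \<open>\<pi>\<close> fixes \<open>1\<close> and \<open>r + 1\<close> and the excess
  \<open>d m = (\<pi> 1 + \<dots> + \<pi> m) - (1 + \<dots> + m)\<close>, which is nonnegative by injectivity, is at most \<open>1\<close>, and
  is \<open>0\<close> for \<open>m \<in> I\<close>. As \<open>\<pi> k = k + d k - d (k - 1)\<close>, the set \<open>{m. d m = 1}\<close> determines \<open>\<pi>\<close>, and
  injectivity of \<open>\<pi>\<close> forces this set to be nonconsecutive. Conversely, the product of the reflections
  indexed by \<open>J\<close> maps \<open>\<theta> + \<rho>\<close> to \<open>\<theta> + \<rho> - \<alpha>\<^sub>J\<close>, so that the vector to be partitioned is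
  a sum of distinct simple roots.
\<close>

section \<open>Coordinates of root sums, of \<theta> and of \<rho>\<close>

lemma simple_root_sum_apply:
  assumes "finite A"
  shows "(\<Sum>i\<in>A. simple_root i) k = of_bool (k \<in> A) - of_bool (1 \<le> k \<and> k - 1 \<in> A)"
  using assms
proof (induction A rule: finite_induct)
  case (insert x F)
  then show ?case by (auto simp: simple_root_apply)
qed simp

lemma root_sum_apply:
  "finite A \<Longrightarrow> root_sum A k = of_bool (k \<in> A) - of_bool (1 \<le> k \<and> k - 1 \<in> A)"
  unfolding root_sum_def by (rule simple_root_sum_apply)

lemma highest_root_apply:
  assumes "r \<ge> 1"
  shows "highest_root r k = of_bool (k = 1) - of_bool (k = r + 1)"
  using assms unfolding highest_root_def by (auto simp: simple_root_sum_apply)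

text \<open>The sum telescopes and reads off the coefficient of \<open>simple_root m\<close>;
  \<open>0 \<notin> A\<close> removes the boundary term at \<open>k = 1\<close>.\<close>

lemma partial_sum_root_sum:
  assumes "finite A" "0 \<notin> A"
  shows "(\<Sum>k = 1..m. root_sum A k) = of_bool (m \<in> A)"
proof (induction m)
  case 0
  then show ?case using assms by simp
next
  case (Suc m)
  then show ?case using assms by (simp add: root_sum_apply)
qed

lemma positive_roots_eq_image:
  "positive_roots r = (\<lambda>(i, j). \<Sum>k = i..j. simple_root k) ` (SIGMA i:{1..r}. {i..r})"
  by (force simp: positive_roots_def)

text \<open>Coordinate \<open>i\<close> is 1 and coordinate \<open>j + 1\<close> is -1, which
  recovers both endpoints. This lets a sum over the set of positive roots become a double sum over
  endpoints.\<close>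

lemma inj_on_interval_root:
  "inj_on (\<lambda>(i, j). \<Sum>k = i..j. simple_root k) (SIGMA i:{1..r}. {i..r})"
proof (rule inj_onI, clarify)
  fix i j i' j'
  assume b: "i \<in> {1..r}" "j \<in> {i..r}" "i' \<in> {1..r}" "j' \<in> {i'..r}"
    and eq: "(\<Sum>k = i..j. simple_root k) = (\<Sum>k = i'..j'. simple_root k)"
  have *: "(\<Sum>k = i..j. simple_root k) l = of_bool (l = i) - of_bool (l = j + 1)"
    if "1 \<le> i" "i \<le> j" for i j l :: nat
    using that by (auto simp: simple_root_sum_apply)
  have E: "of_bool (l = i) - of_bool (l = j + 1) = (of_bool (l = i') - of_bool (l = j' + 1) :: real)" for l
    using fun_cong[OF eq, of l] b by (simp add: *)
  show "i = i' \<and> j = j'"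
    using E[of i] E[of "j + 1"] b by (auto simp: of_bool_def split: if_splits)
qed

text \<open>Coordinate \<open>k\<close> is 1 in the \<open>r + 1 - k\<close> roots starting at
  \<open>k\<close> and -1 in the \<open>k - 1\<close> roots ending at \<open>k - 1\<close>; half the
  difference remains.\<close>

lemma half_sum_apply:
  assumes "k \<in> {1..r + 1}"
  shows "half_sum r k = real r / 2 + 1 - real k"
proof -
  have app: "(\<Sum>x\<in>A. f x) k = (\<Sum>x\<in>A. f x k)" for A :: "(nat \<times> nat) set" and f :: "_ \<Rightarrow> vec"
    by (induction A rule: infinite_finite_induct) auto
  have "(\<Sum>\<beta>\<in>positive_roots r. \<beta>) k
      = (\<Sum>(i, j)\<in>(SIGMA i:{1..r}. {i..r}). (\<Sum>l = i..j. simple_root l) k)"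
    unfolding positive_roots_eq_image sum.reindex[OF inj_on_interval_root] app
    by (rule sum.cong) auto
  also have "\<dots> = (\<Sum>i = 1..r. \<Sum>j = i..r. (\<Sum>l = i..j. simple_root l) k)"
    by (subst sum.Sigma) auto
  also have "\<dots> = (\<Sum>i = 1..r. \<Sum>j = i..r. of_bool (k = i) - of_bool (j = k - 1))"
    using assms by (intro sum.cong) (auto simp: simple_root_sum_apply)
  also have "\<dots> = (\<Sum>i = 1..r. (if i = k then real (r + 1 - k) else 0)
                              - of_bool (i \<le> k - 1))"
  proof (intro sum.cong refl)
    fix i assume "i \<in> {1..r}"
    have "(\<Sum>j = i..r. of_bool (j = k - 1)) = (of_bool (k - 1 \<in> {i..r}) :: real)"
      by (simp add: of_bool_def)
    then show "(\<Sum>j = i..r. of_bool (k = i) - of_bool (j = k - 1))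
        = (if i = k then real (r + 1 - k) else 0) - of_bool (i \<le> k - 1)"
      using assms by (auto simp: sum_subtractf)
  qed
  also have "\<dots> = real (r + 1 - k) - (\<Sum>i = 1..r. of_bool (i \<le> k - 1))"
    using assms by (auto simp: sum_subtractf)
  also have "(\<Sum>i = 1..r. of_bool (i \<le> k - 1)) = real (k - 1)"
  proof -
    have "{i \<in> {1..r}. i \<le> k - 1} = {1..k - 1}" using assms by auto
    then show ?thesis by (simp add: of_bool_def sum.If_cases Int_def)
  qed
  finally show ?thesis using assms by (simp add: half_sum_def of_nat_diff field_simps)
qed

section \<open>Positivity of Kostant's partition function\<close>

text \<open>As \<open>card\<close> is 0 on infinite sets, the passage to existence rests on
  \<open>finite_partitions\<close>.\<close>

lemma kostant_pos_iff:
  "kostant r \<xi> > 0 \<longleftrightarrow> (\<exists>M. set_mset M \<subseteq> positive_roots r \<and> \<Sum>\<^sub># M = \<xi>)"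
  unfolding kostant_def card_gt_0_iff using finite_partitions[of r \<xi>] by auto

text \<open>Every partial coordinate sum of a positive root is 0 or 1, and this nonnegativity is
  additive.\<close>

lemma kostant_pos_imp_partial_sum_nonneg:
  assumes "kostant r \<xi> > 0"
  shows "(\<Sum>k = 1..m. \<xi> k) \<ge> 0"
proof -
  obtain M where M: "set_mset M \<subseteq> positive_roots r" "\<Sum>\<^sub># M = \<xi>"
    using assms by (auto simp: kostant_pos_iff)
  have "(\<Sum>k = 1..m. (\<Sum>\<^sub># M) k) \<ge> 0" using M(1)
  proof (induction M)
    case (add \<beta> M)
    obtain i j where "1 \<le> i" "\<beta> = root_sum {i..j}"
      using add.prems by (auto simp: positive_roots_def root_sum_def)
    then have "(\<Sum>k = 1..m. \<beta> k) \<ge> 0"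
      using partial_sum_root_sum[of "{i..j}" m] by simp
    then show ?case using add by (simp add: sum.distrib)
  qed simp
  then show ?thesis using M(2) by simp
qed

lemma kostant_root_sum_pos:
  assumes "A \<subseteq> {1..r}"
  shows "kostant r (root_sum A) > 0"
  unfolding kostant_pos_iff
proof (intro exI conjI)
  have "simple_root i \<in> positive_roots r" if "i \<in> A" for i
    using that assms unfolding positive_roots_def by (force intro: exI[of _ i])
  moreover have "finite A" using assms finite_subset by blast
  ultimately show "set_mset (image_mset simple_root (mset_set A)) \<subseteq> positive_roots r"
    by auto
  show "\<Sum>\<^sub># (image_mset simple_root (mset_set A)) = root_sum A"
    by (simp add: root_sum_def sum_unfold_sum_mset)
qed

section \<open>The Weyl group as permutations of coordinates\<close>

lemma simple_reflection_eq_comp_transpose: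
  assumes "i \<in> {1..r}"
  shows "simple_reflection r i v = v \<circ> transpose i (i + 1)"
  using assms by (auto simp: simple_reflection_swap fun_eq_iff transpose_def)

lemma BijGroup_UNIV_mult:
  assumes "f \<in> carrier (BijGroup UNIV)" "g \<in> carrier (BijGroup UNIV)"
  shows "f \<otimes>\<^bsub>BijGroup UNIV\<^esub> g = f \<circ> g"
  using assms by (auto simp: BijGroup_def compose_def)

lemma BijGroup_UNIV_one: "\<one>\<^bsub>BijGroup UNIV\<^esub> = id"
  by (auto simp: BijGroup_def)

lemma weyl_group_imp_permutation:
  assumes "\<sigma> \<in> weyl_group r"
  obtains \<pi> where "\<pi> permutes {1..r + 1}" "\<sigma> = (\<lambda>v. v \<circ> \<pi>)"
proof -
  let ?P = "\<lambda>\<sigma> :: vec \<Rightarrow> vec. \<exists>\<pi>. \<pi> permutes {1..r + 1} \<and> \<sigma> = (\<lambda>v. v \<circ> \<pi>)"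
  have refl: "?P (simple_reflection r i)" if "i \<in> {1..r}" for i
    using that by (intro exI[of _ "transpose i (i + 1)"])
      (auto simp: simple_reflection_eq_comp_transpose fun_eq_iff intro: permutes_swap_id)
  have carr: "simple_reflection r ` {1..r} \<subseteq> carrier (BijGroup UNIV)"
    using simple_reflection_Bij by blast
  have "?P \<sigma>" using assms unfolding weyl_group_def
  proof (induction rule: generate.induct)
    case one
    show ?case
      by (intro exI[of _ id]) (auto simp: BijGroup_UNIV_one permutes_def fun_eq_iff)
  next
    case (incl h)
    then show ?case using refl by blast
  next
    case (inv h)
    then obtain i where i: "i \<in> {1..r}" "h = simple_reflection r i" by blast
    \<comment> \<open>Reflections are involutions, so inverses of generators are again
      generators.\<close>
    have "h \<circ> h = id"
      using i by (auto simp: fun_eq_iff simple_reflection_swap)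
    then have "h \<otimes>\<^bsub>BijGroup UNIV\<^esub> h = \<one>\<^bsub>BijGroup UNIV\<^esub>"
      using i simple_reflection_Bij by (simp add: BijGroup_UNIV_mult BijGroup_UNIV_one)
    then have inv_h: "inv\<^bsub>BijGroup UNIV\<^esub> h = h"
      using i simple_reflection_Bij group.inv_equality[OF group_BijGroup] by blast
    show ?case unfolding inv_h using refl i by blast
  next
    case (eng h1 h2)
    then obtain p q where pq: "p permutes {1..r + 1}" "q permutes {1..r + 1}"
      "h1 = (\<lambda>v. v \<circ> p)" "h2 = (\<lambda>v. v \<circ> q)" by blast
    have "h1 \<in> carrier (BijGroup UNIV)" "h2 \<in> carrier (BijGroup UNIV)"
      using eng.hyps group.generate_in_carrier[OF group_BijGroup carr] by auto
    then have "h1 \<otimes>\<^bsub>BijGroup UNIV\<^esub> h2 = h1 \<circ> h2"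
      by (rule BijGroup_UNIV_mult)
    \<comment> \<open>Precomposition reverses the order of the factors.\<close>
    also have "\<dots> = (\<lambda>v. v \<circ> (q \<circ> p))"
      using pq by (simp add: fun_eq_iff)
    finally have "h1 \<otimes>\<^bsub>BijGroup UNIV\<^esub> h2 = (\<lambda>v. v \<circ> (q \<circ> p))" .
    then show ?case using pq permutes_compose by blast
  qed
  then show ?thesis using that by blast
qed

lemma reflection_prod_in_weyl_group:
  assumes "J \<subseteq> {1..r}"
  shows "reflection_prod r J \<in> weyl_group r"
proof -
  let ?G = "BijGroup (UNIV :: vec set)"
  have carr: "simple_reflection r ` {1..r} \<subseteq> carrier ?G"
    using simple_reflection_Bij by blast
  have "foldr (\<lambda>i f. simple_reflection r i \<circ> f) xs id \<in> weyl_group r"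
    if "set xs \<subseteq> {1..r}" for xs
    using that
  proof (induction xs)
    case Nil
    show ?case
      using generate.one[of ?G "simple_reflection r ` {1..r}"]
      by (simp add: weyl_group_def BijGroup_UNIV_one id_def)
  next
    case (Cons x xs)
    let ?f = "foldr (\<lambda>i f. simple_reflection r i \<circ> f) xs id"
    have x: "simple_reflection r x \<in> weyl_group r"
      using Cons.prems unfolding weyl_group_def by (intro generate.incl) auto
    have f: "?f \<in> weyl_group r" by (rule Cons.IH) (use Cons.prems in auto)
    have "simple_reflection r x \<in> carrier ?G" "?f \<in> carrier ?G"
      using x f group.generate_in_carrier[OF group_BijGroup carr] by (auto simp: weyl_group_def)
    then have "simple_reflection r x \<otimes>\<^bsub>?G\<^esub> ?f = simple_reflection r x \<circ> ?f"
      by (rule BijGroup_UNIV_mult)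
    then have "simple_reflection r x \<circ> ?f \<in> weyl_group r"
      using x f generate.eng[of "simple_reflection r x" ?G "simple_reflection r ` {1..r}" ?f]
      by (simp add: weyl_group_def)
    then show ?case by (simp add: comp_def id_def)
  qed
  moreover have "finite J" using assms finite_subset by blast
  ultimately show ?thesis using assms unfolding reflection_prod_def by simp
qed

text \<open>The transpositions of \<open>i\<close> and \<open>i + 1\<close> for
  \<open>i \<in> J\<close> are disjoint, so each newly added factor swaps two coordinates that the
  others leave alone. At \<open>k = 0\<close> truncation gives \<open>k - 1 = 0\<close>, which is
  not in \<open>J\<close>.\<close>

lemma reflection_prod_apply:
  assumes "J \<subseteq> {1..r}" "nonconsecutive J"
  shows "reflection_prod r J v k =
    (if k \<in> J then v (k + 1) else if k - 1 \<in> J then v (k - 1) else v k)"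
proof -
  have "foldr (\<lambda>i f. simple_reflection r i \<circ> f) xs id v k =
    (if k \<in> set xs then v (k + 1) else if k - 1 \<in> set xs then v (k - 1) else v k)"
    if "set xs \<subseteq> {1..r}" "nonconsecutive (set xs)" "distinct xs" for xs
    using that
  proof (induction xs arbitrary: k)
    case (Cons x xs)
    have x: "x \<in> {1..r}" "x + 1 \<notin> set xs" "x - 1 \<notin> set xs" "x \<notin> set xs"
      and nc: "nonconsecutive (set xs)"
      using Cons.prems by (force simp: nonconsecutive_def)+
    note IH = Cons.IH[OF _ nc]
    show ?case
      using x Cons.prems IH[of k] IH[of x] IH[of "x + 1"]
      by (auto simp: simple_reflection_swap)
  qed simp
  moreover have "finite J" using assms finite_subset by blast
  ultimately show ?thesis using assms unfolding reflection_prod_def by simp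
qed

text \<open>For \<open>j \<in> J\<close> the swapped coordinates \<open>j\<close> and
  \<open>j + 1\<close> lie in \<open>{2..r}\<close>, where \<theta> vanishes. There \<rho> drops by
  1 from one coordinate to the next, so each swap subtracts one simple root.\<close>

lemma reflection_prod_weight:
  assumes "r \<ge> 1" "J \<subseteq> {1..r} - {1, r}" "nonconsecutive J"
  shows "reflection_prod r J (highest_root r + half_sum r)
       = highest_root r + half_sum r - root_sum J"
proof
  fix k
  have J: "J \<subseteq> {1..r}" and fin: "finite J" using assms(2) finite_subset by auto
  have bd: "1 < j \<and> j < r" if "j \<in> J" for j using assms(2) that by force
  have nc: "k - 1 \<notin> J" if "k \<in> J" "1 \<le> k"
    using assms(3) that unfolding nonconsecutive_def by force
  note simps = reflection_prod_apply[OF J assms(3)] root_sum_apply[OF fin]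
    highest_root_apply[OF assms(1)] half_sum_apply
  consider "k \<in> J" | l where "k = l + 1" "l \<in> J" "k \<notin> J" | "k \<notin> J" "k - 1 \<notin> J"
    by (metis Suc_eq_plus1 Suc_pred' diff_0_eq_0 not_gr_zero)
  then show "reflection_prod r J (highest_root r + half_sum r) k
       = (highest_root r + half_sum r - root_sum J) k"
  proof cases
    case 1
    then have "1 < k" "k < r" "k - 1 \<notin> J" using bd[of k] nc by auto
    with 1 show ?thesis by (simp add: simps)
  next
    case 2
    then have "1 < l" "l < r" using bd[of l] by auto
    with 2 show ?thesis by (simp add: simps)
  next
    case 3
    then show ?thesis by (simp add: simps(1,2))
  qed
qed

section \<open>Permutations with bounded partial sums\<close>

text \<open>Adjoining 0 to the image gives \<open>m + 1\<close> distinct naturals, whose sum is at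
  least that of \<open>{0..<m + 1}\<close>.\<close>

lemma sum_inj_on_positive_ge:
  fixes \<pi> :: "nat \<Rightarrow> nat"
  assumes "inj_on \<pi> {1..m}" "\<And>k. k \<in> {1..m} \<Longrightarrow> 1 \<le> \<pi> k"
  shows "(\<Sum>k = 1..m. k) \<le> (\<Sum>k = 1..m. \<pi> k)"
proof -
  let ?S = "insert 0 (\<pi> ` {1..m})"
  have "0 \<notin> \<pi> ` {1..m}" using assms(2) by force
  then have c: "card ?S = Suc m" and s: "\<Sum>?S = (\<Sum>k = 1..m. \<pi> k)"
    using assms(1) by (auto simp: card_image sum.reindex)
  have "\<Sum>{0..<Suc m} = (\<Sum>k = 1..m. k)"
    by (simp add: atLeastLessThanSuc_atLeastAtMost sum.atLeast_Suc_atMost)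
  then show ?thesis using card_sum_le_nat_sum[of ?S] c s by simp
qed

text \<open>\<open>u\<close> is the coordinate vector of \<open>\<theta> + \<rho>\<close>, subtracted from the constant \<open>r / 2 + 1\<close>.\<close>

lemma permutation_of_bounded_partial_sums:
  fixes \<pi> :: "nat \<Rightarrow> nat" and r :: nat and I :: "nat set"
  defines "u \<equiv> (\<lambda>k. if k = 1 then 0 else if k = r + 1 then r + 2 else k)"
  assumes r: "r \<ge> 1" and perm: "\<pi> permutes {1..r + 1}"
    and le: "\<And>m. m \<in> {1..r} \<Longrightarrow> (\<Sum>k = 1..m. u (\<pi> k)) + of_bool (m \<in> I) \<le> (\<Sum>k = 1..m. k)"
  obtains J where "J \<subseteq> ({1..r} - I) - {1, r}" "nonconsecutive J"
    "\<And>k. \<pi> k = (if k \<in> J then k + 1 else if k - 1 \<in> J then k - 1 else k)"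
proof -
  have inj: "inj \<pi>" using perm permutes_inj by blast
  have range: "\<pi> k \<in> {1..r + 1}" if "k \<in> {1..r + 1}" for k
    using permutes_in_image[OF perm, of k] that by simp
  have "u (\<pi> 1) \<le> 1" using le[of 1] r by auto
  then have pi1: "\<pi> 1 = 1" using range[of 1] r by (auto simp: u_def split: if_splits)
  \<comment> \<open>Compared with the identity, \<open>u\<close> loses 1 at \<open>1\<close> and
    gains 1 at \<open>r + 1\<close>.\<close>
  have total_u: "(\<Sum>k = 1..r + 1. u (\<pi> k)) = (\<Sum>k = 1..r + 1. k)"
  proof -
    have "(\<Sum>k = 1..r + 1. u (\<pi> k)) = (\<Sum>k = 1..r + 1. u k)"
      using sum.permute[OF perm, of u] by (simp add: o_def)
    moreover have "(\<Sum>k = 1..r + 1. u k + of_bool (k = 1)) = (\<Sum>k = 1..r + 1. k + of_bool (k = r + 1))"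
      using r by (intro sum.cong) (auto simp: u_def)
    ultimately show ?thesis using r by (simp add: sum.distrib of_bool_def)
  qed
  \<comment> \<open>The bound at \<open>m = r\<close> leaves at least \<open>r + 1\<close> for the
    last term, and only \<open>u (r + 1)\<close> is that large.\<close>
  have "u (\<pi> (r + 1)) \<ge> r + 1" using total_u le[of r] r by simp
  then have pir: "\<pi> (r + 1) = r + 1"
    using range[of "r + 1"] r by (auto simp: u_def split: if_splits)
  \<comment> \<open>Since \<open>\<pi>\<close> fixes \<open>1\<close> and \<open>r + 1\<close>, only
    the term at \<open>k = 1\<close> differs.\<close>
  have sum_pi: "(\<Sum>k = 1..m. \<pi> k) = (\<Sum>k = 1..m. u (\<pi> k)) + 1" if m: "m \<in> {1..r}" for m
  proof -
    have "\<pi> k = u (\<pi> k) + of_bool (k = 1)" if "k \<in> {1..m}" for k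
      using that m pi1 pir inj_eq[OF inj, of k 1] inj_eq[OF inj, of k "r + 1"]
      by (auto simp: u_def)
    then have "(\<Sum>k = 1..m. \<pi> k) = (\<Sum>k = 1..m. u (\<pi> k) + of_bool (k = 1))"
      by (intro sum.cong) auto
    then show ?thesis using m by (simp add: sum.distrib of_bool_def)
  qed
  \<comment> \<open>The subtraction is on naturals; the next fact shows that it does not truncate
    for \<open>m \<le> r + 1\<close>.\<close>
  define d where "d m = (\<Sum>k = 1..m. \<pi> k) - (\<Sum>k = 1..m. k)" for m
  have d: "(\<Sum>k = 1..m. \<pi> k) = (\<Sum>k = 1..m. k) + d m" if "m \<le> r + 1" for m
  proof -
    have "(\<Sum>k = 1..m. k) \<le> (\<Sum>k = 1..m. \<pi> k)"
      using that range inj by (intro sum_inj_on_positive_ge) (auto intro: inj_on_subset)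
    then show ?thesis by (simp add: d_def)
  qed
  have d_le: "d m + of_bool (m \<in> I) \<le> 1" if "m \<in> {1..r}" for m
    using le[OF that] sum_pi[OF that] d[of m] that by simp
  have "(\<Sum>k = 1..r + 1. \<pi> k) = (\<Sum>k = 1..r + 1. k)"
    using sum.permute[OF perm, of "\<lambda>k. k"] by (simp add: o_def)
  then have d_bd: "d 0 = 0" "d 1 = 0" "d r = 0" "d (r + 1) = 0"
    using pi1 pir by (auto simp: d_def)
  have step: "\<pi> (k + 1) + d k = k + 1 + d (k + 1)" if "k \<le> r" for k
    using d[of k] d[of "k + 1"] that by simp
  \<comment> \<open>By induction the excess before a nonzero one is 0, so there \<open>\<pi>\<close>
    takes the value one above its argument. A second excess of 1 right after would repeat that
    value.\<close>
  have nc: "d (m + 1) = 0" if "m \<le> r" "d m \<noteq> 0" for m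
    using that
  proof (induction m)
    case (Suc m)
    have "d m = 0" using Suc by auto
    moreover have d1: "d (Suc m) = 1" using d_le[of "Suc m"] Suc.prems by auto
    ultimately have "\<pi> (Suc m) = Suc m + 1" using step[of m] Suc.prems by simp
    then have "\<pi> (Suc m + 1) \<noteq> Suc m + 1" using inj_eq[OF inj, of "Suc m" "Suc m + 1"] by auto
    then have "d (Suc m + 1) \<noteq> 1" using step[of "Suc m"] d1 Suc.prems by simp
    \<comment> \<open>\<open>d_le\<close> stops at \<open>r\<close>; the index \<open>r + 1\<close>
      is covered by \<open>d_bd\<close>.\<close>
    moreover have "d (Suc m + 1) \<le> 1"
      using d_le[of "Suc m + 1"] d_bd Suc.prems by (cases "Suc m = r") auto
    ultimately show ?case by simp
  qed (use d_bd in simp)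
  define J where "J = {m \<in> {1..r}. d m \<noteq> 0}"
  have d_J: "d m = of_bool (m \<in> J)" if "m \<le> r + 1" for m
    using d_le[of m] d_bd that by (cases "m \<in> {1..r}"; cases "m = 0"; cases "m = r + 1") (auto simp: J_def)
  have ncJ: "nonconsecutive J" using nc by (auto simp: nonconsecutive_def J_def)
  show ?thesis
  proof (rule that)
    show "J \<subseteq> ({1..r} - I) - {1, r}"
      using d_le d_bd by (force simp: J_def)
    show "nonconsecutive J" by (rule ncJ)
    fix k
    show "\<pi> k = (if k \<in> J then k + 1 else if k - 1 \<in> J then k - 1 else k)"
    proof (cases "k \<in> {1..r + 1}")
      case True
      then obtain l where l: "k = l + 1" "l \<le> r"
        by (metis add.commute atLeastAtMost_iff le_Suc_ex nat_add_left_cancel_le)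
      then show ?thesis
        using step[of l] d_J[of l] d_J[of "l + 1"] ncJ by (auto simp: nonconsecutive_def)
    next
      case False
      then have "\<pi> k = k" using perm by (auto simp: permutes_def)
      then show ?thesis using False by (auto simp: J_def)
    qed
  qed
qed

section \<open>From the alternation set to partial sums, and the equivalence\<close>

text \<open>The constant \<open>r / 2 + 1\<close> cancels between the permuted \<theta> + \<rho> and
  \<rho>, so nonnegative partial sums become an inequality of naturals; the indicator of
  \<open>I\<close> comes from \<open>root_sum I\<close>.\<close>

lemma alternation_partial_sums:
  fixes r :: nat and \<pi> :: "nat \<Rightarrow> nat"
  defines "u \<equiv> (\<lambda>k. if k = 1 then 0 else if k = r + 1 then r + 2 else k)"
  assumes r: "r \<ge> 1" and I: "I \<subseteq> {1..r}" and perm: "\<pi> permutes {1..r + 1}"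
    and pos: "kostant r (((highest_root r + half_sum r) \<circ> \<pi>) - half_sum r - root_sum I) > 0"
    and m: "m \<in> {1..r}"
  shows "(\<Sum>k = 1..m. u (\<pi> k)) + of_bool (m \<in> I) \<le> (\<Sum>k = 1..m. k)"
proof -
  have fin: "finite I" "0 \<notin> I" using I finite_subset by auto
  have wt: "(highest_root r + half_sum r) k = real r / 2 + 1 - real (u k)" if "k \<in> {1..r + 1}" for k
    using that r by (auto simp: u_def highest_root_apply half_sum_apply)
  have "(((highest_root r + half_sum r) \<circ> \<pi>) - half_sum r - root_sum I) k
      = real k - real (u (\<pi> k)) - root_sum I k" if "k \<in> {1..m}" for k
  proof -
    have "k \<in> {1..r + 1}" using that m by auto
    moreover from this have "\<pi> k \<in> {1..r + 1}" using permutes_in_image[OF perm, of k] by simp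
    ultimately show ?thesis using wt[of "\<pi> k"] by (simp add: half_sum_apply)
  qed
  then have "(\<Sum>k = 1..m. real k - real (u (\<pi> k)) - root_sum I k)
      = (\<Sum>k = 1..m. (((highest_root r + half_sum r) \<circ> \<pi>) - half_sum r - root_sum I) k)"
    by (intro sum.cong) auto
  also have "\<dots> \<ge> 0" by (rule kostant_pos_imp_partial_sum_nonneg[OF pos])
  finally have "(\<Sum>k = 1..m. real k - real (u (\<pi> k)) - root_sum I k) \<ge> 0" .
  then have "real ((\<Sum>k = 1..m. u (\<pi> k)) + of_bool (m \<in> I)) \<le> real (\<Sum>k = 1..m. k)"
    using partial_sum_root_sum[OF fin, of m] by (simp add: sum_subtractf)
  then show ?thesis by (rule of_nat_le_iff[THEN iffD1])
qed

theorem theorem2p6: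
  fixes r :: nat and I :: "nat set" and \<sigma> :: "vec \<Rightarrow> vec"
  assumes "r \<ge> 1" and "I \<subseteq> {1..r}" and "I \<noteq> {}"
  shows "\<sigma> \<in> weyl_alternation_set r (highest_root r) (root_sum I) \<longleftrightarrow>
    \<sigma> = id \<or>
    (\<exists>J. J \<subseteq> ({1..r} - I) - {1, r} \<and> nonconsecutive J \<and> \<sigma> = reflection_prod r J)"
proof
  assume "\<sigma> \<in> weyl_alternation_set r (highest_root r) (root_sum I)"
  then have \<sigma>: "\<sigma> \<in> weyl_group r"
    and pos: "kostant r (\<sigma> (highest_root r + half_sum r) - half_sum r - root_sum I) > 0"
    by (auto simp: weyl_alternation_set_def)
  obtain \<pi> where \<pi>: "\<pi> permutes {1..r + 1}" "\<sigma> = (\<lambda>v. v \<circ> \<pi>)"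
    using weyl_group_imp_permutation[OF \<sigma>] .
  have pos': "kostant r (((highest_root r + half_sum r) \<circ> \<pi>) - half_sum r - root_sum I) > 0"
    using pos \<pi>(2) by simp
  obtain J where J: "J \<subseteq> ({1..r} - I) - {1, r}" "nonconsecutive J"
    "\<And>k. \<pi> k = (if k \<in> J then k + 1 else if k - 1 \<in> J then k - 1 else k)"
    using permutation_of_bounded_partial_sums[OF assms(1) \<pi>(1)
        alternation_partial_sums[OF assms(1,2) \<pi>(1) pos']] by blast
  have "J \<subseteq> {1..r}" using J(1) by blast
  then have "\<sigma> = reflection_prod r J"
    using J by (auto simp: \<pi>(2) fun_eq_iff reflection_prod_apply)
  then show "\<sigma> = id \<or>
    (\<exists>J. J \<subseteq> ({1..r} - I) - {1, r} \<and> nonconsecutive J \<and> \<sigma> = reflection_prod r J)"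
    using J by blast
next
  assume "\<sigma> = id \<or>
    (\<exists>J. J \<subseteq> ({1..r} - I) - {1, r} \<and> nonconsecutive J \<and> \<sigma> = reflection_prod r J)"
  \<comment> \<open>The identity is the case of empty \<open>J\<close>, which merges the two
    alternatives.\<close>
  moreover have "id = reflection_prod r {}" "nonconsecutive {}"
    by (simp_all add: reflection_prod_def nonconsecutive_def)
  ultimately obtain J where J: "J \<subseteq> ({1..r} - I) - {1, r}" "nonconsecutive J"
    "\<sigma> = reflection_prod r J" by blast
  have "J \<subseteq> {1..r}" using J(1) by blast
  then have fin: "finite J" "finite I"
    using assms(2) finite_subset by auto
  have "J \<subseteq> {1..r} - {1, r}" using J(1) by blast
  then have "\<sigma> (highest_root r + half_sum r) - half_sum r - root_sum I
      = highest_root r - root_sum J - root_sum I"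
    using assms(1) J by (simp add: reflection_prod_weight)
  \<comment> \<open>As \<open>I\<close> and \<open>J\<close> are disjoint, no simple root is
    subtracted twice and no coefficient becomes negative.\<close>
  also have "\<dots> = root_sum ({1..r} - J - I)"
  proof -
    have "J \<subseteq> {1..r}" "I \<subseteq> {1..r} - J" using J(1) assms(2) by auto
    then show ?thesis using fin by (simp add: highest_root_def root_sum_def sum_diff)
  qed
  finally have "kostant r (\<sigma> (highest_root r + half_sum r) - half_sum r - root_sum I) > 0"
    using kostant_root_sum_pos[of "{1..r} - J - I" r] by auto
  moreover have "\<sigma> \<in> weyl_group r"
    using J reflection_prod_in_weyl_group[of J r] by blast
  ultimately show "\<sigma> \<in> weyl_alternation_set r (highest_root r) (root_sum I)"
    by (simp add: weyl_alternation_set_def)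
qed

end
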